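(* Let $M$ be an irreducible explicit Runge--Kutta method with positive SSP coefficient $\mathcal{C}>0$. Then $M$ has effective order at most four; that is, $M$ does not have effective order $q$ for any integer $q\ge 5$.
   Context: Runge--Kutta methods. An $s$-stage Runge--Kutta method is given by real coefficients $A=(a_{ij})\in\mathbb{R}^{s\times s}$, $\bm{b}\in\mathbb{R}^s$, with $c_i=\sum_j a_{ij}$; it is explicit if $a_{ij}=0$ for $j\ge i$. For $\bm{u}'=\bm{F}(\bm{u})$ it computes $\bm{Y}_i=\bm{u}^n+\Delta t\sum_j a_{ij}\bm{F}(\bm{Y}_j)$ and $\bm{u}^{n+1}=\bm{u}^n+\Delta t\sum_i b_i\bm{F}(\bm{Y}_i)$. Irreducibility. The method is irreducible if it cannot be reduced to an equivalent method with fewer stages in either of the following standard senses: (i) there is no nonempty set $T$ of stage indices with $b_j=0$ for all $j\in T$ and $a_{ij}=0$ for all $i\notin T$, $j\in T$; (ii) there is no partition of $\{1,\dots,s\}$ into fewer than $s$ nonempty classes $I_1,\dots,I_m$ such that $\sum_{k\in I_l}a_{ik}=\sum_{k\in I_l}a_{jk}$ for every $l$ and whenever $i,j$ lie in the same class. SSP coefficient. Let $K$ be the $(s+1)\times s$ matrix whose first $s$ rows are $A$ and whose last row is $\bm{b}^T$, and let $\bm{e}_m$ be the vector of ones of length $m$. The SSP coefficient $\mathcal{C}$ of an irreducible method is the largest $r\ge 0$ such that $I+rA$ is invertible and, componentwise, $$K(I+rA)^{-1}\ge 0,\qquad \bm{e}_{s+1}-rK(I+rA)^{-1}\bm{e}_s\ge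 0.$$ In particular, $\mathcal{C}>0$ means that these conditions hold for some $r>0$. (For irreducible methods this is equivalent to: $\|\bm{u}^{n+1}\|\le\|\bm{u}^n\|$ whenever $0\le\Delta t\le\mathcal{C}\,\Delta t_{\mathrm{FE}}$ and $\|\bm{u}+\tau\bm{F}(\bm{u})\|\le\|\bm{u}\|$ for all $\bm{u}$ and all $0\le\tau\le\Delta t_{\mathrm{FE}}$, for any convex functional $\|\cdot\|$.) Elementary weights. Let $r(t)$ be the number of vertices of a rooted tree $t$. Write $t=[t_1,\dots,t_m]$ for the tree obtained by joining the roots of $t_1,\dots,t_m$ to a new root; the single-vertex tree is $[\,]$. For a Runge--Kutta method put $D_i([t_1,\dots,t_m])=\prod_{k=1}^m\sum_j a_{ij}D_j(t_k)$ (empty product $=1$). Its elementary weight is $\alpha(t)=\sum_i b_iD_i(t)$, with $\alpha(\emptyset)=1$ for the empty tree. So each method corresponds to a function $\alpha$ on rooted trees. Butcher group $G$. $G$ is the set of real functions on rooted trees (including $\emptyset$) taking value $1$ at $\emptyset$, with product $$(\alpha\beta)(t)=\sum_{u}\beta(u)\prod_{t'\in t\setminus u}\alpha(t'),$$ where $u$ ranges over the empty tree and all subtrees of $t$ (connected vertex subsets) containing the root of $t$, and $t\setminus u$ is the forest of rooted trees left after deleting $u$ from $t$ (for $u=\emptyset$ it is $\{t\}$). The product $\alpha\beta$ corresponds to applying the method of $\alpha$ first and then the method of $\beta$. The identity $1\in G$ is $1$ at $\emptyset$ and $0$ at every nonempty tree. The exact evolution $E\in G$ is $E(t)=1/\gamma(t)$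 for nonempty $t$, where $\gamma([t_1,\dots,t_m])=r(t)\prod_k\gamma(t_k)$. Effective order. A Runge--Kutta method with corresponding $\alpha\in G$ has effective order $q$ if there exist Runge--Kutta methods $S$ and $S^{-1}$ (not required to be explicit) with corresponding elements $\beta,\beta^{-1}\in G$ such that $(\beta^{-1}\beta)(t)=1(t)$ and $(\beta\alpha\beta^{-1})(t)=E(t)$ for every tree $t$ with $r(t)\le q$. *)

theory Defs
  imports
    "HOL-Library.Multiset"
    "HOL-Library.Disjoint_Sets"
    "HOL-Library.Extended_Real"
    "HOL-Library.Product_Plus"
    "Jordan_Normal_Form.Matrix"
begin

section \<open>Runge--Kutta methods\<close>

text \<open>
  An \<open>s\<close>-stage method is given by its coefficients \<open>A\<close> and \<open>b\<close>; stages are numbered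
  \<open>0, \<dots>, s - 1\<close>. The abscissae \<open>c\<^sub>i\<close> are determined by \<open>A\<close> and are not recorded.
\<close>

definition rk_method :: "nat \<Rightarrow> real mat \<Rightarrow> real vec \<Rightarrow> bool" where
  "rk_method s A b \<longleftrightarrow> 0 < s \<and> A \<in> carrier_mat s s \<and> b \<in> carrier_vec s"

definition rk_explicit :: "nat \<Rightarrow> real mat \<Rightarrow> bool" where
  "rk_explicit s A \<longleftrightarrow> (\<forall>i<s. \<forall>j<s. i \<le> j \<longrightarrow> A $$ (i, j) = 0)"

definition unused_stages_reducible :: "nat \<Rightarrow> real mat \<Rightarrow> real vec \<Rightarrow> bool" where
  "unused_stages_reducible s A b \<longleftrightarrow>
     (\<exists>T. T \<noteq> {} \<and> T \<subseteq> {..<s} \<and> (\<forall>j\<in>T. b $ j = 0) \<and>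
          (\<forall>i\<in>{..<s} - T. \<forall>j\<in>T. A $$ (i, j) = 0))"

definition equal_stages_reducible :: "nat \<Rightarrow> real mat \<Rightarrow> bool" where
  "equal_stages_reducible s A \<longleftrightarrow>
     (\<exists>P. partition_on {..<s} P \<and> card P < s \<and>
          (\<forall>I\<in>P. \<forall>i\<in>I. \<forall>j\<in>I. \<forall>L\<in>P. (\<Sum>k\<in>L. A $$ (i, k)) = (\<Sum>k\<in>L. A $$ (j, k))))"

definition rk_irreducible :: "nat \<Rightarrow> real mat \<Rightarrow> real vec \<Rightarrow> bool" where
  "rk_irreducible s A b \<longleftrightarrow>
     \<not> unused_stages_reducible s A b \<and> \<not> equal_stages_reducible s A"


section \<open>SSP coefficient\<close>

definition rk_K :: "nat \<Rightarrow> real mat \<Rightarrow> real vec \<Rightarrow> real mat" where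
  "rk_K s A b = mat (s + 1) s (\<lambda>(i, j). if i < s then A $$ (i, j) else b $ j)"

definition ones_vec :: "nat \<Rightarrow> real vec" where
  "ones_vec m = vec m (\<lambda>_. 1)"

text \<open>
  \<open>B\<close> is the inverse of \<open>I + r A\<close>; it is unique when it exists. The order on matrices and
  on vectors is the componentwise one.
\<close>

definition ssp_conditions :: "nat \<Rightarrow> real mat \<Rightarrow> real vec \<Rightarrow> real \<Rightarrow> bool" where
  "ssp_conditions s A b r \<longleftrightarrow>
     (\<exists>B \<in> carrier_mat s s.
        inverts_mat (1\<^sub>m s + r \<cdot>\<^sub>m A) B \<and> inverts_mat B (1\<^sub>m s + r \<cdot>\<^sub>m A) \<and>
        0\<^sub>m (s + 1) s \<le> rk_K s A b * B \<and>
        0\<^sub>v (s + 1) \<le> ones_vec (s + 1) - r \<cdot>\<^sub>v ((rk_K s A b * B) *\<^sub>v ones_vec s))"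

text \<open>
  The supremum is taken in the extended reals because the admissible \<open>r\<close> can be unbounded
  (as for the implicit Euler method) or absent.
\<close>

definition ssp_coeff :: "nat \<Rightarrow> real mat \<Rightarrow> real vec \<Rightarrow> ereal" where
  "ssp_coeff s A b = Sup (ereal ` {r. 0 \<le> r \<and> ssp_conditions s A b r})"

lemma ssp_coeff_pos_iff: "0 < ssp_coeff s A b \<longleftrightarrow> (\<exists>r>0. ssp_conditions s A b r)"
  unfolding ssp_coeff_def by (auto simp: less_Sup_iff intro: less_imp_le)


section \<open>Rooted trees\<close>

text \<open>
  \<open>Node ts\<close> is the tree \<open>[t\<^sub>1, \<dots>, t\<^sub>m]\<close>. As the branches form a multiset, this type
  consists of the nonempty unordered rooted trees up to isomorphism. Where the empty tree
  is also allowed, it is \<open>None\<close> in \<open>rtree option\<close>.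
\<close>

datatype rtree = Node "rtree multiset"

primrec nvertices :: "rtree \<Rightarrow> nat" where
  "nvertices (Node ts) = 1 + (\<Sum>t\<in>#ts. nvertices t)"

definition tree_order :: "rtree option \<Rightarrow> nat" where
  "tree_order t = (case t of None \<Rightarrow> 0 | Some t' \<Rightarrow> nvertices t')"

primrec tree_gamma :: "rtree \<Rightarrow> nat" where
  "tree_gamma (Node ts) = nvertices (Node ts) * (\<Prod>t\<in>#ts. tree_gamma t)"

text \<open>
  \<open>root_subtrees t\<close> is the multiset of all pairs \<open>(u, t - u)\<close> where \<open>u\<close> ranges over the
  connected vertex subsets of \<open>t\<close> containing the root and the forest \<open>t - u\<close> is what remains
  of \<open>t\<close> after deleting \<open>u\<close>; a pair occurs as often as there are vertex subsets giving
  rise to it. Such a vertex subset of \<open>[t\<^sub>1, \<dots>, t\<^sub>m]\<close> amounts to an independent choice, for every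
  branch \<open>t\<^sub>k\<close>, of either the empty set or a connected subset containing the root of \<open>t\<^sub>k\<close>.
  \<open>branch_choices\<close> lists the possibilities for one branch, and \<open>join_choices\<close> combines
  independent choices; the first component collects the branches of \<open>u\<close>, the second one the
  trees deleted.
\<close>

type_synonym choice = "rtree multiset \<times> rtree multiset"

definition join_choices :: "choice multiset \<Rightarrow> choice multiset \<Rightarrow> choice multiset" where
  "join_choices X Y = (\<Sum>(us, fs)\<in>#X. {#(us + us', fs + fs'). (us', fs') \<in># Y#})"

definition branch_choices ::
    "rtree \<Rightarrow> (rtree \<times> rtree multiset) multiset \<Rightarrow> choice multiset" where
  "branch_choices t R = {#({#}, {#t#})#} + {#({#u#}, fs). (u, fs) \<in># R#}"

primrec root_subtrees :: "rtree \<Rightarrow> (rtree \<times> rtree multiset) multiset" where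
  "root_subtrees (Node ts) =
     {#(Node us, fs). (us, fs) \<in>#
        fold_mset join_choices {#({#}, {#})#}
          {#branch_choices t (root_subtrees t). t \<in># ts#}#}"

interpretation join_choices: comp_fun_commute join_choices
proof
  have join: "join_choices X Y = (\<Sum>p\<in>#X. {#p + q. q \<in># Y#})" for X Y
    unfolding join_choices_def by (simp add: case_prod_unfold plus_prod_def)
  have shift: "{#p + q. q \<in># (\<Sum>q\<in>#Y. {#q + z. z \<in># Z#})#} = (\<Sum>q\<in>#Y. {#p + q + z. z \<in># Z#})"
    for p :: choice and Y Z
    by (induction Y) (simp_all add: multiset.map_comp o_def add.assoc)
  have "join_choices X (join_choices Y Z) = join_choices Y (join_choices X Z)" for X Y Z
    unfolding join shift
    by (subst sum_mset.swap) (simp add: add.commute)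
  then show "join_choices Y \<circ> join_choices X = join_choices X \<circ> join_choices Y" for X Y
    by auto
qed


section \<open>The Butcher group\<close>

definition butcher_group :: "(rtree option \<Rightarrow> real) set" where
  "butcher_group = {\<alpha>. \<alpha> None = 1}"

text \<open>
  In the second equation the first summand is the term of the empty subtree.
\<close>

fun butcher_prod ::
    "(rtree option \<Rightarrow> real) \<Rightarrow> (rtree option \<Rightarrow> real) \<Rightarrow> rtree option \<Rightarrow> real" where
  "butcher_prod \<alpha> \<beta> None = \<beta> None * \<alpha> None"
| "butcher_prod \<alpha> \<beta> (Some t) =
     \<beta> None * \<alpha> (Some t) +
     (\<Sum>(u, fs)\<in>#root_subtrees t. \<beta> (Some u) * (\<Prod>t'\<in>#fs. \<alpha> (Some t')))"

definition butcher_one :: "rtree option \<Rightarrow> real" where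
  "butcher_one t = (case t of None \<Rightarrow> 1 | Some _ \<Rightarrow> 0)"

definition exact_evolution :: "rtree option \<Rightarrow> real" where
  "exact_evolution t = (case t of None \<Rightarrow> 1 | Some t' \<Rightarrow> 1 / real (tree_gamma t'))"


section \<open>Elementary weights and effective order\<close>

primrec stage_weight :: "nat \<Rightarrow> real mat \<Rightarrow> rtree \<Rightarrow> nat \<Rightarrow> real" where
  "stage_weight s A (Node ts) =
     (\<lambda>i. \<Prod>t\<in>#ts. \<Sum>j<s. A $$ (i, j) * stage_weight s A t j)"

definition elementary_weight :: "nat \<Rightarrow> real mat \<Rightarrow> real vec \<Rightarrow> rtree option \<Rightarrow> real" where
  "elementary_weight s A b t =
     (case t of None \<Rightarrow> 1 | Some t' \<Rightarrow> \<Sum>i<s. b $ i * stage_weight s A t' i)"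

lemma butcher_group_closed:
  "elementary_weight s A b \<in> butcher_group"
  "butcher_one \<in> butcher_group"
  "exact_evolution \<in> butcher_group"
  "\<alpha> \<in> butcher_group \<Longrightarrow> \<beta> \<in> butcher_group \<Longrightarrow> butcher_prod \<alpha> \<beta> \<in> butcher_group"
  by (simp_all add: butcher_group_def elementary_weight_def butcher_one_def exact_evolution_def)

definition has_effective_order :: "nat \<Rightarrow> real mat \<Rightarrow> real vec \<Rightarrow> nat \<Rightarrow> bool" where
  "has_effective_order s A b q \<longleftrightarrow>
     (\<exists>s1 A1 b1 s2 A2 b2.
        rk_method s1 A1 b1 \<and> rk_method s2 A2 b2 \<and>
        (let \<alpha> = elementary_weight s A b;
             \<beta> = elementary_weight s1 A1 b1;
             \<beta>' = elementary_weight s2 A2 b2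
         in \<forall>t. tree_order t \<le> q \<longrightarrow>
              butcher_prod \<beta>' \<beta> t = butcher_one t \<and>
              butcher_prod (butcher_prod \<beta> \<alpha>) \<beta>' t = exact_evolution t))"

end

theory Submission
  imports Defs
begin

text \<open>
  For a method \<open>\<alpha>\<close> put \<open>v\<^sub>i = c\<^sub>i\<^sup>2 / 2 - (A c)\<^sub>i\<close>. The number \<open>\<Sum>\<^sub>i b\<^sub>i v\<^sub>i\<^sup>2\<close> is a linear combination,
  the \<open>defect\<close> of \<open>\<alpha>\<close>, of the elementary weights of three trees of order five. Running \<open>\<beta>\<close> before
  \<open>\<alpha>\<close> shifts every \<open>v\<^sub>i\<close> by one constant \<open>\<kappa>\<close>, so the defect of \<open>\<beta> \<alpha>\<close> is that of \<open>\<beta>\<close> plus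
  \<open>\<Sum>\<^sub>i b\<^sub>i (v\<^sub>i + \<kappa>)\<^sup>2\<close>; for \<open>E \<beta>\<close> the shift vanishes, and so does the defect of \<open>E\<close>. Effective
  order five gives \<open>\<beta> \<alpha> = E \<beta>\<close> up to order five, hence \<open>\<Sum>\<^sub>i b\<^sub>i (v\<^sub>i + \<kappa>)\<^sup>2 = 0\<close>.
  A positive SSP coefficient and irreducibility force \<open>b > 0\<close>, so every \<open>v\<^sub>i\<close> equals \<open>- \<kappa>\<close>.
  The first stage of an explicit method has \<open>v\<^sub>1 = 0\<close>, so \<open>\<kappa> = 0\<close>, and then \<open>c = 0\<close> stage by stage.
  This contradicts \<open>\<Sum>\<^sub>i b\<^sub>i c\<^sub>i = 1 / 2\<close>, the condition at the tree of order two.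
\<close>

section \<open>Butcher products on the trees that occur in the argument\<close>

abbreviation leaf :: rtree where
  "leaf \<equiv> Node {#}"

abbreviation chain2 :: rtree where
  "chain2 \<equiv> Node {#leaf#}"

abbreviation bush4 :: rtree where
  "bush4 \<equiv> Node {#leaf, leaf, leaf, leaf#}"

abbreviation mixed_tree :: rtree where
  "mixed_tree \<equiv> Node {#leaf, leaf, chain2#}"

abbreviation double_chain :: rtree where
  "double_chain \<equiv> Node {#chain2, chain2#}"

text \<open>With these rules the simplifier enumerates the root subtrees of a concrete tree.\<close>

lemma join_choices_simps [simp]:
  "join_choices {#} Y = {#}"
  "join_choices (add_mset p X) Y = {#(fst p + us', snd p + fs'). (us', fs') \<in># Y#} + join_choices X Y"
  by (simp_all add: join_choices_def case_prod_unfold)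

lemma butcher_prod_leaf:
  assumes "Y None = 1"
  shows "butcher_prod X Y (Some leaf) = X (Some leaf) + Y (Some leaf)"
  using assms by simp

lemma butcher_prod_chain2:
  assumes "Y None = 1"
  shows "butcher_prod X Y (Some chain2) =
    X (Some chain2) + X (Some leaf) * Y (Some leaf) + Y (Some chain2)"
  using assms by (simp add: branch_choices_def)

text \<open>There are \<open>4 choose k\<close> ways to keep k of the four leaves; each deleted leaf
  contributes a factor \<open>X (Some leaf)\<close>.\<close>

lemma butcher_prod_bush4:
  assumes "Y None = 1"
  shows "butcher_prod X Y (Some bush4) =
    X (Some bush4) + X (Some leaf) ^ 4 * Y (Some leaf) + 4 * X (Some leaf) ^ 3 * Y (Some chain2)
    + 6 * X (Some leaf) ^ 2 * Y (Some (Node {#leaf, leaf#}))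
    + 4 * X (Some leaf) * Y (Some (Node {#leaf, leaf, leaf#})) + Y (Some bush4)"
  using assms by (simp add: branch_choices_def eval_nat_numeral)

lemma butcher_prod_mixed_tree:
  assumes "Y None = 1"
  shows "butcher_prod X Y (Some mixed_tree) =
    X (Some mixed_tree) + X (Some leaf) ^ 2 * X (Some chain2) * Y (Some leaf)
    + (X (Some leaf) ^ 3 + 2 * X (Some leaf) * X (Some chain2)) * Y (Some chain2)
    + X (Some leaf) ^ 2 * Y (Some (Node {#chain2#}))
    + (X (Some chain2) + 2 * X (Some leaf) ^ 2) * Y (Some (Node {#leaf, leaf#}))
    + X (Some leaf) * Y (Some (Node {#leaf, leaf, leaf#}))
    + 2 * X (Some leaf) * Y (Some (Node {#leaf, chain2#})) + Y (Some mixed_tree)"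
  using assms by (simp add: branch_choices_def eval_nat_numeral add_mset_commute algebra_simps)

lemma butcher_prod_double_chain:
  assumes "Y None = 1"
  shows "butcher_prod X Y (Some double_chain) =
    X (Some double_chain) + X (Some chain2) ^ 2 * Y (Some leaf)
    + 2 * X (Some leaf) * X (Some chain2) * Y (Some chain2)
    + 2 * X (Some chain2) * Y (Some (Node {#chain2#}))
    + X (Some leaf) ^ 2 * Y (Some (Node {#leaf, leaf#}))
    + 2 * X (Some leaf) * Y (Some (Node {#leaf, chain2#})) + Y (Some double_chain)"
  using assms by (simp add: branch_choices_def eval_nat_numeral add_mset_commute algebra_simps)

lemma butcher_prod_small_trees:
  assumes "Y None = 1"
  shows "butcher_prod X Y (Some (Node {#leaf, leaf#})) =
      X (Some (Node {#leaf, leaf#})) + X (Some leaf) ^ 2 * Y (Some leaf)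
      + 2 * X (Some leaf) * Y (Some chain2) + Y (Some (Node {#leaf, leaf#}))"
    and "butcher_prod X Y (Some (Node {#chain2#})) =
      X (Some (Node {#chain2#})) + X (Some chain2) * Y (Some leaf)
      + X (Some leaf) * Y (Some chain2) + Y (Some (Node {#chain2#}))"
    and "butcher_prod X Y (Some (Node {#leaf, leaf, leaf#})) =
      X (Some (Node {#leaf, leaf, leaf#})) + X (Some leaf) ^ 3 * Y (Some leaf)
      + 3 * X (Some leaf) ^ 2 * Y (Some chain2)
      + 3 * X (Some leaf) * Y (Some (Node {#leaf, leaf#})) + Y (Some (Node {#leaf, leaf, leaf#}))"
    and "butcher_prod X Y (Some (Node {#leaf, chain2#})) =
      X (Some (Node {#leaf, chain2#})) + X (Some leaf) * X (Some chain2) * Y (Some leaf)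
      + (X (Some chain2) + X (Some leaf) ^ 2) * Y (Some chain2)
      + X (Some leaf) * Y (Some (Node {#leaf, leaf#}))
      + X (Some leaf) * Y (Some (Node {#chain2#})) + Y (Some (Node {#leaf, chain2#}))"
  using assms
  by (simp_all add: branch_choices_def eval_nat_numeral add_mset_commute algebra_simps)

lemmas butcher_prod_trees =
  butcher_prod_leaf butcher_prod_chain2 butcher_prod_small_trees
  butcher_prod_bush4 butcher_prod_mixed_tree butcher_prod_double_chain

declare butcher_prod.simps(2) [simp del]

text \<open>Both sides expand, tree by tree, to the same polynomial in the values of the three
  factors.\<close>

lemma butcher_prod_assoc:
  assumes "X None = 1" "Y None = 1" "Z None = 1"
    and "t \<in> {leaf, chain2, bush4, mixed_tree, double_chain}"
  shows "butcher_prod (butcher_prod X Y) Z (Some t) = butcher_prod X (butcher_prod Y Z) (Some t)"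
  using assms(4)
  by (elim insertE emptyE; simp add: assms(1-3) butcher_prod_trees eval_nat_numeral;
    simp add: algebra_simps)

section \<open>Effective order five without the inverse method\<close>

lemma butcher_prod_effective_order_5:
  assumes "has_effective_order s A b q" "5 \<le> q"
  obtains \<beta> where "\<beta> None = 1"
    and "\<And>t. t \<in> {leaf, chain2, bush4, mixed_tree, double_chain} \<Longrightarrow>
      butcher_prod \<beta> (elementary_weight s A b) (Some t) = butcher_prod exact_evolution \<beta> (Some t)"
proof -
  define \<alpha> where "\<alpha> = elementary_weight s A b"
  obtain s1 A1 b1 s2 A2 b2 where
    order: "\<forall>t. tree_order t \<le> q \<longrightarrow>
      butcher_prod (elementary_weight s2 A2 b2) (elementary_weight s1 A1 b1) t = butcher_one t \<and>
      butcher_prod (butcher_prod (elementary_weight s1 A1 b1) \<alpha>) (elementary_weight s2 A2 b2) t =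
        exact_evolution t"
    using assms(1) unfolding has_effective_order_def Let_def \<alpha>_def by blast
  define \<beta> where "\<beta> = elementary_weight s1 A1 b1"
  define \<beta>' where "\<beta>' = elementary_weight s2 A2 b2"
  have one: "\<beta> None = 1" "\<beta>' None = 1"
    by (simp_all add: \<beta>_def \<beta>'_def elementary_weight_def)
  have \<alpha>_one: "\<alpha> None = 1"
    by (simp add: \<alpha>_def elementary_weight_def)
  define \<Gamma> where "\<Gamma> = butcher_prod \<beta> \<alpha>"
  have \<Gamma>_one: "\<Gamma> None = 1"
    by (simp add: \<Gamma>_def one \<alpha>_one)
  have E: "exact_evolution (Some t) = butcher_prod \<Gamma> \<beta>' (Some t)"
    and I: "butcher_prod \<beta>' \<beta> (Some t) = 0" if "nvertices t \<le> 5" for t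
    using order[rule_format, of "Some t"] that assms(2)
    by (simp_all add: tree_order_def \<Gamma>_def \<beta>_def \<beta>'_def butcher_one_def)
  have "\<Gamma> (Some t) = butcher_prod exact_evolution \<beta> (Some t)"
    if t: "t \<in> {leaf, chain2, bush4, mixed_tree, double_chain}" for t
  proof -
    \<comment> \<open>A product at \<open>t\<close> involves only values at trees with at most as
      many vertices as \<open>t\<close>, so the identities up to order five may be substituted into
      either factor.\<close>
    have "butcher_prod \<Gamma> (butcher_prod \<beta>' \<beta>) (Some t) = \<Gamma> (Some t)"
      using t by (elim insertE emptyE) (simp_all add: butcher_prod_trees[where X = \<Gamma>] one I)
    moreover have "butcher_prod exact_evolution \<beta> (Some t) =
        butcher_prod (butcher_prod \<Gamma> \<beta>') \<beta> (Some t)"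
      using t by (elim insertE emptyE) (simp_all add: butcher_prod_trees[where Y = \<beta>] one E)
    moreover have "butcher_prod (butcher_prod \<Gamma> \<beta>') \<beta> (Some t) =
        butcher_prod \<Gamma> (butcher_prod \<beta>' \<beta>) (Some t)"
      by (rule butcher_prod_assoc) (fact \<Gamma>_one one t)+
    ultimately show ?thesis
      by simp
  qed
  then show thesis
    using that[of \<beta>] one(1) by (simp add: \<Gamma>_def \<alpha>_def)
qed

section \<open>The defect and its behaviour under composition\<close>

text \<open>The coefficients are those of \<open>(c^2 / 2 - d)^2\<close> with
  \<open>d = A c\<close>.\<close>

definition defect :: "(rtree option \<Rightarrow> real) \<Rightarrow> real" where
  "defect X = X (Some bush4) / 4 - X (Some mixed_tree) + X (Some double_chain)"

text \<open>Every term of the product's defect that mixes \<open>X\<close> and \<open>Y\<close>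
  carries the factor \<open>X (Some leaf) ^ 2 / 2 - X (Some chain2)\<close>. It serves for
  \<open>X = exact_evolution\<close>, with arbitrary \<open>Y\<close>.\<close>

lemma defect_butcher_prod:
  assumes "Y None = 1" "X (Some chain2) = X (Some leaf) ^ 2 / 2"
  shows "defect (butcher_prod X Y) = defect X + defect Y"
  using assms(1)
  by (simp add: defect_def butcher_prod_trees assms(2) power_divide eval_nat_numeral algebra_simps)

definition abscissa :: "nat \<Rightarrow> real mat \<Rightarrow> nat \<Rightarrow> real" where
  "abscissa s A i = (\<Sum>j<s. A $$ (i, j))"

text \<open>The residual of the simplifying assumption C(2), that is, of stage order two.\<close>

definition stage_defect :: "nat \<Rightarrow> real mat \<Rightarrow> nat \<Rightarrow> real" where
  "stage_defect s A i = abscissa s A i ^ 2 / 2 - (\<Sum>j<s. A $$ (i, j) * abscissa s A j)"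

text \<open>Write x and p for the values of \<open>X\<close> at \<open>leaf\<close> and
  \<open>chain2\<close>. Running \<open>X\<close> first turns \<open>c i\<close> into
  \<open>c i + x\<close> and \<open>d i\<close> into \<open>d i + x * c i + p\<close>, so
  \<open>c i ^ 2 / 2 - d i\<close> grows by \<open>x^2 / 2 - p\<close>, the same for all
  stages.\<close>

lemma defect_butcher_prod_weight:
  "defect (butcher_prod X (elementary_weight s A b)) = defect X +
     (\<Sum>i<s. b $ i * (stage_defect s A i + (X (Some leaf) ^ 2 / 2 - X (Some chain2))) ^ 2)"
proof -
  define \<alpha> where "\<alpha> = elementary_weight s A b"
  define \<kappa> where "\<kappa> = X (Some leaf) ^ 2 / 2 - X (Some chain2)"
  define c where "c = abscissa s A"
  define d where "d i = (\<Sum>j<s. A $$ (i, j) * c j)" for i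
  have one: "\<alpha> None = 1"
    by (simp add: \<alpha>_def elementary_weight_def)
  have weight: "\<alpha> (Some (Node ts)) =
      (\<Sum>i<s. b $ i * (\<Prod>t\<in>#ts. \<Sum>j<s. A $$ (i, j) * stage_weight s A t j))" for ts
    by (simp add: \<alpha>_def elementary_weight_def)
  have leaf_weight: "(\<Sum>j<s. A $$ (i, j) * stage_weight s A leaf j) = c i" for i
    by (simp add: c_def abscissa_def)
  have chain2_weight: "(\<Sum>j<s. A $$ (i, j) * stage_weight s A chain2 j) = d i" for i
    by (simp add: d_def c_def abscissa_def)
  have defect_eq: "stage_defect s A i = c i ^ 2 / 2 - d i" for i
    by (simp add: stage_defect_def d_def c_def)
  have weights:
    "\<alpha> (Some leaf) = (\<Sum>i<s. b $ i)"
    "\<alpha> (Some chain2) = (\<Sum>i<s. b $ i * c i)"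
    "\<alpha> (Some (Node {#leaf, leaf#})) = (\<Sum>i<s. b $ i * c i ^ 2)"
    "\<alpha> (Some (Node {#chain2#})) = (\<Sum>i<s. b $ i * d i)"
    "\<alpha> (Some (Node {#leaf, leaf, leaf#})) = (\<Sum>i<s. b $ i * c i ^ 3)"
    "\<alpha> (Some (Node {#leaf, chain2#})) = (\<Sum>i<s. b $ i * (c i * d i))"
    "\<alpha> (Some bush4) = (\<Sum>i<s. b $ i * c i ^ 4)"
    "\<alpha> (Some mixed_tree) = (\<Sum>i<s. b $ i * (c i ^ 2 * d i))"
    "\<alpha> (Some double_chain) = (\<Sum>i<s. b $ i * d i ^ 2)"
    by (simp_all only: weight leaf_weight chain2_weight image_mset_add_mset image_mset_empty
        prod_mset.add_mset prod_mset.empty mult_1_right) (simp_all add: eval_nat_numeral mult.assoc)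
  have "(\<Sum>i<s. b $ i * (stage_defect s A i + \<kappa>) ^ 2) =
      (\<Sum>i<s. b $ i * c i ^ 4 / 4 - b $ i * (c i ^ 2 * d i) + b $ i * d i ^ 2
        + \<kappa> * (b $ i * c i ^ 2) - 2 * \<kappa> * (b $ i * d i) + \<kappa> ^ 2 * b $ i)"
    by (rule sum.cong) (simp_all add: defect_eq eval_nat_numeral field_simps)
  also have "\<dots> = \<alpha> (Some bush4) / 4 - \<alpha> (Some mixed_tree) + \<alpha> (Some double_chain)
      + \<kappa> * \<alpha> (Some (Node {#leaf, leaf#})) - 2 * \<kappa> * \<alpha> (Some (Node {#chain2#}))
      + \<kappa> ^ 2 * \<alpha> (Some leaf)"
    by (simp add: weights sum.distrib sum_subtractf sum_distrib_left sum_divide_distrib)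
  also have "\<dots> = defect (butcher_prod X \<alpha>) - defect X"
    by (simp add: defect_def butcher_prod_trees one \<kappa>_def eval_nat_numeral field_simps)
  finally show ?thesis
    by (simp add: \<alpha>_def \<kappa>_def)
qed

section \<open>Positivity of the weights from the SSP conditions\<close>

text \<open>
  Here \<open>M = A (I + r A)\<^sup>-\<^sup>1\<close> and \<open>m\<^sup>T = b\<^sup>T (I + r A)\<^sup>-\<^sup>1\<close>.
\<close>

lemma ssp_explicitE:
  assumes rk: "rk_method s A b" and explicit: "rk_explicit s A" and ssp: "ssp_conditions s A b r"
  obtains M m where
    "\<And>i j. i < s \<Longrightarrow> j < s \<Longrightarrow> 0 \<le> M i j"
    "\<And>i j. i < s \<Longrightarrow> j < s \<Longrightarrow> i \<le> j \<Longrightarrow> M i j = 0"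
    "\<And>j. j < s \<Longrightarrow> 0 \<le> m j"
    "\<And>i j. i < s \<Longrightarrow> j < s \<Longrightarrow> A $$ (i, j) = M i j + r * (\<Sum>k<s. M i k * A $$ (k, j))"
    "\<And>j. j < s \<Longrightarrow> b $ j = m j + r * (\<Sum>k<s. m k * A $$ (k, j))"
    "\<And>j. j < s \<Longrightarrow> b $ j = m j + r * (\<Sum>k<s. b $ k * M k j)"
proof -
  define K where "K = rk_K s A b"
  have A: "A \<in> carrier_mat s s"
    using rk by (auto simp: rk_method_def)
  have K: "K \<in> carrier_mat (s + 1) s"
    by (simp add: K_def rk_K_def)
  have K_index: "K $$ (i, j) = (if i < s then A $$ (i, j) else b $ j)" if "i < s + 1" "j < s" for i j
    using that by (simp add: K_def rk_K_def)
  obtain B where B: "B \<in> carrier_mat s s"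
    and inv: "(1\<^sub>m s + r \<cdot>\<^sub>m A) * B = 1\<^sub>m s" "B * (1\<^sub>m s + r \<cdot>\<^sub>m A) = 1\<^sub>m s"
    and nonneg: "0\<^sub>m (s + 1) s \<le> K * B"
    using ssp A unfolding ssp_conditions_def inverts_mat_def K_def by auto
  define N where "N = K * B"
  have N: "N \<in> carrier_mat (s + 1) s"
    using K B by (simp add: N_def)
  have N_index: "N $$ (i, j) = (\<Sum>k<s. K $$ (i, k) * B $$ (k, j))" if "i < s + 1" "j < s" for i j
    using that K B by (simp add: N_def scalar_prod_def atLeast0LessThan)
  have N_nonneg: "0 \<le> N $$ (i, j)" if "i < s + 1" "j < s" for i j
    using nonneg that K B by (auto simp: N_def less_eq_mat_def)
  have AB_index: "(A * B) $$ (i, j) = N $$ (i, j)" if "i < s" "j < s" for i j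
    using that A B by (simp add: N_index K_index scalar_prod_def atLeast0LessThan)
  have rA: "r \<cdot>\<^sub>m A \<in> carrier_mat s s"
    using A by simp
  have "K = K * (B * (1\<^sub>m s + r \<cdot>\<^sub>m A))"
    using right_mult_one_mat[OF K] by (simp only: inv)
  also have "\<dots> = N * (1\<^sub>m s + r \<cdot>\<^sub>m A)"
    unfolding N_def by (rule assoc_mult_mat[symmetric, OF K B add_carrier_mat[OF rA]])
  also have "\<dots> = N * 1\<^sub>m s + N * (r \<cdot>\<^sub>m A)"
    by (rule mult_add_distrib_mat[OF N one_carrier_mat rA])
  also have "\<dots> = N + r \<cdot>\<^sub>m (N * A)"
    by (simp only: right_mult_one_mat[OF N] mult_smult_distrib[OF N A])
  finally have K_right: "K = N + r \<cdot>\<^sub>m (N * A)" .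
  \<comment> \<open>Using the inverse on the other side puts \<open>K\<close> instead of
    \<open>N\<close> to the left in the correction term.\<close>
  have "K = K * ((1\<^sub>m s + r \<cdot>\<^sub>m A) * B)"
    using right_mult_one_mat[OF K] by (simp only: inv)
  also have "\<dots> = K * (B + r \<cdot>\<^sub>m (A * B))"
    by (simp only: add_mult_distrib_mat[OF one_carrier_mat rA B] left_mult_one_mat[OF B]
        mult_smult_assoc_mat[OF A B])
  also have "\<dots> = N + K * (r \<cdot>\<^sub>m (A * B))"
    unfolding N_def by (rule mult_add_distrib_mat[OF K B]) (use A B in simp)
  also have "\<dots> = N + r \<cdot>\<^sub>m (K * (A * B))"
    by (simp only: mult_smult_distrib[OF K mult_carrier_mat[OF A B]])
  finally have K_left: "K = N + r \<cdot>\<^sub>m (K * (A * B))" .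
  have right: "K $$ (i, j) = N $$ (i, j) + r * (\<Sum>k<s. N $$ (i, k) * A $$ (k, j))"
    if "i < s + 1" "j < s" for i j
  proof -
    have "K $$ (i, j) = (N + r \<cdot>\<^sub>m (N * A)) $$ (i, j)"
      by (rule arg_cong[OF K_right])
    then show ?thesis
      using that A N by (simp add: scalar_prod_def atLeast0LessThan)
  qed
  have left: "K $$ (i, j) = N $$ (i, j) + r * (\<Sum>k<s. K $$ (i, k) * N $$ (k, j))"
    if "i < s + 1" "j < s" for i j
  proof -
    define C where "C = A * B"
    have C: "C \<in> carrier_mat s s"
      using A B by (simp add: C_def)
    have "K $$ (i, j) = (N + r \<cdot>\<^sub>m (K * C)) $$ (i, j)"
      unfolding C_def by (rule arg_cong[OF K_left])
    also have "\<dots> = N $$ (i, j) + r * (\<Sum>k<s. K $$ (i, k) * C $$ (k, j))"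
      using that C K N by (simp add: scalar_prod_def atLeast0LessThan)
    finally show ?thesis
      using that by (simp add: C_def AB_index del: index_mult_mat)
  qed
  \<comment> \<open>In \<open>left\<close>, row i of \<open>N\<close> depends only on earlier rows,
    as \<open>A\<close> is strictly lower triangular.\<close>
  have upper: "N $$ (i, j) = 0" if "i < s" "j < s" "i \<le> j" for i j
    using that
  proof (induction i rule: less_induct)
    case (less i)
    have A_upper: "A $$ (i, k) = 0" if "k < s" "i \<le> k" for k
      using explicit less.prems that by (simp add: rk_explicit_def)
    have "A $$ (i, k) * N $$ (k, j) = 0" if "k < s" for k
      using less that by (cases "k < i") (simp_all add: A_upper)
    then have "(\<Sum>k<s. A $$ (i, k) * N $$ (k, j)) = 0"
      by (intro sum.neutral ballI) (simp only: lessThan_iff)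
    then show ?case
      using left[of i j] A_upper[of j] less.prems by (simp add: K_index)
  qed
  show thesis
  \<comment> \<open>The last row of \<open>N\<close>, with index \<open>s\<close>, belongs to
    \<open>b\<close>.\<close>
  proof (rule that[of "\<lambda>i j. N $$ (i, j)" "\<lambda>j. N $$ (s, j)"])
    show "A $$ (i, j) = N $$ (i, j) + r * (\<Sum>k<s. N $$ (i, k) * A $$ (k, j))" if "i < s" "j < s" for i j
      using right[of i j] that by (simp add: K_index)
    show "b $ j = N $$ (s, j) + r * (\<Sum>k<s. N $$ (s, k) * A $$ (k, j))"
      "b $ j = N $$ (s, j) + r * (\<Sum>k<s. b $ k * N $$ (k, j))" if "j < s" for j
      using right[of s j] left[of s j] that by (simp_all add: K_index)
  qed (simp_all add: N_nonneg upper)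
qed

text \<open>In \<open>A = M + r M A\<close> with \<open>M\<close> nonnegative and strictly lower
  triangular, row i of \<open>A\<close> is built from earlier rows.\<close>

lemma ssp_explicit_nonneg:
  assumes "rk_method s A b" "rk_explicit s A" "0 \<le> r" "ssp_conditions s A b r"
    and "i < s" "j < s"
  shows "0 \<le> A $$ (i, j)"
proof (rule ssp_explicitE[OF assms(1,2,4)])
  fix M :: "nat \<Rightarrow> nat \<Rightarrow> real" and m :: "nat \<Rightarrow> real"
  assume M: "\<And>i j. i < s \<Longrightarrow> j < s \<Longrightarrow> 0 \<le> M i j"
    and M_upper: "\<And>i j. i < s \<Longrightarrow> j < s \<Longrightarrow> i \<le> j \<Longrightarrow> M i j = 0"
    and A_eq: "\<And>i j. i < s \<Longrightarrow> j < s \<Longrightarrow> A $$ (i, j) = M i j + r * (\<Sum>k<s. M i k * A $$ (k, j))"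
  show ?thesis
    using assms(5)
  proof (induction i rule: less_induct)
    case (less i)
    have "0 \<le> M i k * A $$ (k, j)" if "k < s" for k
      using less that by (cases "k < i") (simp_all add: M M_upper)
    then have "0 \<le> (\<Sum>k<s. M i k * A $$ (k, j))"
      by (intro sum_nonneg) simp
    then show ?case
      using A_eq[OF less.prems assms(6)] M[OF less.prems assms(6)] assms(3) by simp
  qed
qed

text \<open>The stages of weight zero form a set \<open>T\<close> that no other stage uses, so
  irreducibility makes \<open>T\<close> empty.\<close>

lemma ssp_irreducible_pos:
  assumes "rk_method s A b" "rk_explicit s A" "\<not> unused_stages_reducible s A b"
    and r: "0 < r" and ssp: "ssp_conditions s A b r"
    and "i < s"
  shows "0 < b $ i"
proof (rule ssp_explicitE[OF assms(1,2) ssp])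
  fix M :: "nat \<Rightarrow> nat \<Rightarrow> real" and m :: "nat \<Rightarrow> real"
  assume M: "\<And>i j. i < s \<Longrightarrow> j < s \<Longrightarrow> 0 \<le> M i j"
    and M_upper: "\<And>i j. i < s \<Longrightarrow> j < s \<Longrightarrow> i \<le> j \<Longrightarrow> M i j = 0"
    and m: "\<And>j. j < s \<Longrightarrow> 0 \<le> m j"
    and A_eq: "\<And>i j. i < s \<Longrightarrow> j < s \<Longrightarrow> A $$ (i, j) = M i j + r * (\<Sum>k<s. M i k * A $$ (k, j))"
    and b_right: "\<And>j. j < s \<Longrightarrow> b $ j = m j + r * (\<Sum>k<s. m k * A $$ (k, j))"
    and b_left: "\<And>j. j < s \<Longrightarrow> b $ j = m j + r * (\<Sum>k<s. b $ k * M k j)"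
  have A_nonneg: "0 \<le> A $$ (i, j)" if "i < s" "j < s" for i j
    using ssp_explicit_nonneg[OF assms(1,2) less_imp_le[OF r] ssp that] .
  have b_nonneg: "0 \<le> b $ j" if "j < s" for j
    using that less_imp_le[OF r]
    by (subst b_right) (auto intro!: add_nonneg_nonneg mult_nonneg_nonneg sum_nonneg m A_nonneg)
  \<comment> \<open>If \<open>b $ j = 0\<close>, the nonnegative summands in \<open>b_left\<close>
    must all vanish.\<close>
  have M_zero: "M k j = 0" if "j < s" "k < s" "b $ j = 0" "b $ k \<noteq> 0" for j k
  proof -
    have "(\<Sum>k<s. b $ k * M k j) = 0"
    proof (rule antisym)
      show "0 \<le> (\<Sum>k<s. b $ k * M k j)"
        using that(1) by (intro sum_nonneg mult_nonneg_nonneg) (simp_all add: b_nonneg M)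
      have "r * (\<Sum>k<s. b $ k * M k j) \<le> 0"
        using b_left[OF that(1)] m[OF that(1)] that(3) by simp
      then show "(\<Sum>k<s. b $ k * M k j) \<le> 0"
        using r by (simp add: mult_le_0_iff)
    qed
    then have "b $ k * M k j = 0"
      using that(1,2) by (subst (asm) sum_nonneg_eq_0_iff) (simp_all add: b_nonneg M)
    then show ?thesis
      using that(4) by simp
  qed
  have A_zero: "A $$ (i, j) = 0" if "j < s" "b $ j = 0" "i < s" "b $ i \<noteq> 0" for i j
    using that(3,4)
  proof (induction i rule: less_induct)
    case (less i)
    \<comment> \<open>If \<open>b $ k = 0\<close>, the first factor vanishes by
      \<open>M_zero\<close>; otherwise induction applies for \<open>k < i\<close>, and
      \<open>M\<close> is zero for \<open>i \<le> k\<close>.\<close>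
    have "M i k * A $$ (k, j) = 0" if "k < s" for k
      using less M_zero[of k i] that \<open>j < s\<close> \<open>b $ j = 0\<close>
      by (cases "b $ k = 0"; cases "k < i") (simp_all add: M_upper)
    then have "(\<Sum>k<s. M i k * A $$ (k, j)) = 0"
      by (intro sum.neutral ballI) (simp only: lessThan_iff)
    then show ?case
      using A_eq[of i j] M_zero[of j i] less.prems that by simp
  qed
  define T where "T = {j. j < s \<and> b $ j = 0}"
  have "T = {}"
  proof (rule ccontr)
    assume "T \<noteq> {}"
    moreover have "\<forall>i\<in>{..<s} - T. \<forall>j\<in>T. A $$ (i, j) = 0"
      using A_zero by (auto simp: T_def)
    ultimately have "unused_stages_reducible s A b"
      unfolding unused_stages_reducible_def by (intro exI[of _ T]) (auto simp: T_def)
    with assms(3) show False ..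
  qed
  then show ?thesis
    using b_nonneg[OF assms(6)] assms(6) by (force simp: T_def)
qed

section \<open>Contradiction with effective order five\<close>

theorem corollary4p3:
  fixes s :: nat and A :: "real mat" and b :: "real vec"
  assumes "rk_method s A b"
    and "rk_irreducible s A b"
    and "rk_explicit s A"
    and "0 < ssp_coeff s A b"
  shows "\<forall>q\<ge>5. \<not> has_effective_order s A b q"
proof (intro allI impI notI)
  fix q :: nat
  assume q: "5 \<le> q" and order: "has_effective_order s A b q"
  obtain r where r: "0 < r" "ssp_conditions s A b r"
    using assms(4) ssp_coeff_pos_iff by blast
  have b_pos: "0 < b $ i" if "i < s" for i
    using ssp_irreducible_pos[OF assms(1,3) _ r that] assms(2) by (simp add: rk_irreducible_def)
  have upper: "A $$ (i, j) = 0" if "i < s" "j < s" "i \<le> j" for i j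
    using assms(3) that by (simp add: rk_explicit_def)
  have s: "0 < s"
    using assms(1) by (simp add: rk_method_def)
  obtain \<beta> where \<beta>: "\<beta> None = 1"
    and eq: "\<And>t. t \<in> {leaf, chain2, bush4, mixed_tree, double_chain} \<Longrightarrow>
      butcher_prod \<beta> (elementary_weight s A b) (Some t) = butcher_prod exact_evolution \<beta> (Some t)"
    using butcher_prod_effective_order_5[OF order q] by blast
  define \<kappa> where "\<kappa> = \<beta> (Some leaf) ^ 2 / 2 - \<beta> (Some chain2)"
  have "defect (butcher_prod \<beta> (elementary_weight s A b)) = defect (butcher_prod exact_evolution \<beta>)"
    by (simp add: defect_def eq)
  also have "\<dots> = defect \<beta>"
  proof -
    \<comment> \<open>The values of E are 1/5, 1/10 and 1/20, and 1/20 - 1/10 + 1/20 = 0.\<close>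
    have "defect exact_evolution = 0"
      by (simp add: defect_def exact_evolution_def)
    then show ?thesis
      by (subst defect_butcher_prod) (simp_all add: \<beta> exact_evolution_def)
  qed
  finally have "(\<Sum>i<s. b $ i * (stage_defect s A i + \<kappa>) ^ 2) = 0"
    by (simp add: defect_butcher_prod_weight \<kappa>_def)
  then have squares: "\<forall>i\<in>{..<s}. b $ i * (stage_defect s A i + \<kappa>) ^ 2 = 0"
    by (subst (asm) sum_nonneg_eq_0_iff) (simp_all add: b_pos less_imp_le)
  have stage: "stage_defect s A i = - \<kappa>" if "i < s" for i
  proof -
    have "b $ i * (stage_defect s A i + \<kappa>) ^ 2 = 0"
      using squares that by blast
    then show ?thesis
      using b_pos[OF that] by (simp add: eq_neg_iff_add_eq_0)
  qed
  have "stage_defect s A 0 = 0"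
    using s by (simp add: stage_defect_def abscissa_def upper)
  with stage[OF s] have "\<kappa> = 0"
    by simp
  \<comment> \<open>Zero stage defect means \<open>c i ^ 2 / 2\<close> is a combination of earlier
    abscissae, which vanish by induction.\<close>
  have abscissa: "abscissa s A i = 0" if "i < s" for i
    using that
  proof (induction i rule: less_induct)
    case (less i)
    have "A $$ (i, j) * abscissa s A j = 0" if "j < s" for j
      using less that by (cases "j < i") (simp_all add: upper)
    then have "(\<Sum>j<s. A $$ (i, j) * abscissa s A j) = 0"
      by (intro sum.neutral ballI) (simp only: lessThan_iff)
    then show ?case
      using stage[OF less.prems] \<open>\<kappa> = 0\<close> by (simp add: stage_defect_def)
  qed
  have "elementary_weight s A b (Some leaf) = 1"
    using eq[of leaf] \<beta> by (simp add: butcher_prod_leaf elementary_weight_def exact_evolution_def)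
  \<comment> \<open>Since the weight at \<open>leaf\<close> is 1, the terms in \<beta>
    cancel.\<close>
  then have "elementary_weight s A b (Some chain2) = 1 / 2"
    using eq[of chain2] \<beta>
    by (simp add: butcher_prod_chain2 elementary_weight_def exact_evolution_def)
  moreover have "elementary_weight s A b (Some chain2) = 0"
    using abscissa by (simp add: elementary_weight_def abscissa_def)
  ultimately show False
    by simp
qed

end
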